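(* The pointwise continuity of type 2 functionals, i.e. the sentence $$\forall\Phi^{(\mathbb N\to\mathbb N)\to\mathbb N}\,\forall f^{\mathbb N\to\mathbb N}\,\exists N^{\mathbb N}\,\forall g^{\mathbb N\to\mathbb N}\,\bigl(\forall n\le N\,(fn=_{\mathbb N}gn)\to\Phi f=_{\mathbb N}\Phi g\bigr)$$ of the language of $\mathrm{HA}^\omega$, is $\mathcal I^{\mathrm{cp}}$-interpretable.
   Context: $\mathrm{HA}^\omega$ is Heyting arithmetic in all finite types generated by $\sigma\to\tau$ from ground types $\mathbb N$ and $\mathbb B$ (Booleans), with combinators, $0$, successor, recursors, Boolean constants and conditionals; its only relation symbols are logical equalities $\equiv_\sigma$ at each type ($=_{\mathbb N}$ is $\equiv_{\mathbb N}$). $x\le y$ abbreviates a quantifier-free equation of type $\mathbb N$ (e.g. $x\dot-y\equiv_{\mathbb N}0$) and $\forall n\le N(\dots)$ abbreviates $\forall n^{\mathbb N}(n\le N\to\dots)$. Formulas use $\bot,\wedge,\to,\forall x^\sigma,\exists x^\sigma$. Target language: the language of $\mathrm{HA}^\omega$ with the extra type constructor $\sigma\mapsto\sigma^*$ (non-empty finite subsets) and constants for singleton, union, indexed union $\bigcup_{w\in t}qw$, membership, combinators, conditionals and recursors for all these types, and $\mathrm m:\mathbb N^*\to\mathbb N$ (maximum). $\mathcal S^\omega_*$ is the structure with $\mathcal S_{\mathbb N}=\mathbb N$, $\mathcal S_{\mathbb B}=\{0,1\}$, $\mathcal S_{\rho\to\sigma}$ all functions from $\mathcal S_\rho$ to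 $\mathcal S_\sigma$, $\mathcal S_{\sigma^*}$ all non-empty finite subsets of $\mathcal S_\sigma$. The target theory $T$ is the set of sentences true in $\mathcal S^\omega_*$. Witnessing types are the types of the target language; witnessing terms are its terms. $\mathcal L^{\mathcal I}$ adds to the language of $\mathrm{HA}^\omega$ a unary predicate $\mathcal I_\sigma(x^\sigma)$ for each type. Boldface letters are (possibly empty) tuples, $\forall\boldsymbol b\in\boldsymbol B$ is componentwise. $\mathcal I^{\mathrm{cp}}$ (canonical upon precise) is given by: $\langle\mathcal I_{\mathbb N}(x)\rangle^n$ is $x=n$; $\langle\mathcal I_{\mathbb B}(i)\rangle^j$ is $i=j$; and $\langle\mathcal I_{\rho\to\sigma}(h)\rangle^{\boldsymbol f,\boldsymbol g}_{\boldsymbol a,\boldsymbol d}:\equiv\forall x^\rho(\forall\boldsymbol b\in\boldsymbol g\boldsymbol a\boldsymbol d\,\langle\mathcal I_\rho(x)\rangle^{\boldsymbol a}_{\boldsymbol b}\to\langle\mathcal I_\sigma(hx)\rangle^{\boldsymbol f\boldsymbol a}_{\boldsymbol d})$. In particular, $\langle\mathcal I_{\mathbb N\to\mathbb N}(f)\rangle^g_k$ is $fk=gk$ and $\langle\mathcal I_{(\mathbb N\to\mathbb N)\to\mathbb N}(\Phi)\rangle^{\Psi,\mu}_h$ is $\forall f(\forall k\in\mu h(fk=hk)\to\Phi f=\Psi h)$, with $\mu:(\mathbb N\to\mathbb N)\to\mathbb N^*$, $\Psi:(\mathbb N\to\mathbb N)\to\mathbb N$. $\mathcal U$-interpretation of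 formulas of $\mathcal L^{\mathcal I}$: $\langle x\equiv_\sigma y\rangle$ is $x=y$; $\langle\bot\rangle:\equiv\bot$; $\langle A\wedge B\rangle^{\boldsymbol a,\boldsymbol c}_{\boldsymbol b,\boldsymbol d}:\equiv\langle A\rangle^{\boldsymbol a}_{\boldsymbol b}\wedge\langle B\rangle^{\boldsymbol c}_{\boldsymbol d}$; $\langle A\to B\rangle^{\boldsymbol f,\boldsymbol g}_{\boldsymbol a,\boldsymbol d}:\equiv\forall\boldsymbol b\in\boldsymbol g\boldsymbol a\boldsymbol d\,\langle A\rangle^{\boldsymbol a}_{\boldsymbol b}\to\langle B\rangle^{\boldsymbol f\boldsymbol a}_{\boldsymbol d}$; $\langle\forall xA\rangle^{\boldsymbol a}_{\boldsymbol b}:\equiv\forall x\langle A\rangle^{\boldsymbol a}_{\boldsymbol b}$; $\langle\exists xA\rangle^{\boldsymbol a}_{\boldsymbol B}:\equiv\exists x\forall\boldsymbol b\in\boldsymbol B\langle A\rangle^{\boldsymbol a}_{\boldsymbol b}$. $A$ is $\mathcal U$-interpretable if there are closed witnessing terms $\boldsymbol t$ with $T\vdash\forall\boldsymbol b\langle A\rangle^{\boldsymbol t}_{\boldsymbol b}$. $A^{\mathcal I}$ replaces $\forall x^\sigma(\dots)$ by $\forall x^\sigma(\mathcal I_\sigma(x)\to\dots)$ and $\exists x^\sigma(\dots)$ by $\exists x^\sigma(\mathcal I_\sigma(x)\wedge\dots)$. A sentence $A$ of $\mathrm{HA}^\omega$ is $\mathcal I^{\mathrm{cp}}$-interpretable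 if $A^{\mathcal I}$ is $\mathcal U$-interpretable when the atomic formulas $\mathcal I_\sigma(x)$ are interpreted by the clauses of $\mathcal I^{\mathrm{cp}}$ (that is, $x=n$ at type $\mathbb N$, $i=j$ at type $\mathbb B$, and the stated canonical clause for $\langle\mathcal I_{\rho\to\sigma}(h)\rangle^{\boldsymbol f,\boldsymbol g}_{\boldsymbol a,\boldsymbol d}$ at function types) and $x\equiv_\sigma y$ is interpreted as $x=y$. *)

theory Defs
  imports Main "HOL-Library.FuncSet" "HOL-Library.FSet"
begin

section \<open>Types, terms and formulas\<close>

datatype ty = TN | TB | Fun ty ty (infixr "\<Rrightarrow>" 65) | Star ty

text \<open>The types of \<open>HA\<^sup>\<omega>\<close> are the star-free ones.\<close>

primrec star_free :: "ty \<Rightarrow> bool" where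
  "star_free TN = True"
| "star_free TB = True"
| "star_free (\<rho> \<Rrightarrow> \<sigma>) = (star_free \<rho> \<and> star_free \<sigma>)"
| "star_free (Star \<sigma>) = False"

primrec level :: "ty \<Rightarrow> nat" where
  "level TN = 0"
| "level TB = 0"
| "level (\<rho> \<Rrightarrow> \<sigma>) = max (Suc (level \<rho>)) (level \<sigma>)"
| "level (Star \<sigma>) = level \<sigma>"

definition subtype_closed :: "ty set \<Rightarrow> bool" where
  "subtype_closed D \<longleftrightarrow>
     (\<forall>\<rho> \<sigma>. \<rho> \<Rrightarrow> \<sigma> \<in> D \<longrightarrow> \<rho> \<in> D \<and> \<sigma> \<in> D) \<and> (\<forall>\<sigma>. Star \<sigma> \<in> D \<longrightarrow> \<sigma> \<in> D)"

datatype con =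
    CombK ty ty | CombS ty ty ty | Zero | Succ | Rec ty | TT | FF | Cond ty
  | SSing ty | SUn ty | SUnion ty ty | SMem ty | SMax

primrec con_type :: "con \<Rightarrow> ty" where
  "con_type (CombK \<rho> \<sigma>) = \<rho> \<Rrightarrow> \<sigma> \<Rrightarrow> \<rho>"
| "con_type (CombS \<rho> \<sigma> \<tau>) = (\<rho> \<Rrightarrow> \<sigma> \<Rrightarrow> \<tau>) \<Rrightarrow> (\<rho> \<Rrightarrow> \<sigma>) \<Rrightarrow> \<rho> \<Rrightarrow> \<tau>"
| "con_type Zero = TN"
| "con_type Succ = TN \<Rrightarrow> TN"
| "con_type (Rec \<sigma>) = \<sigma> \<Rrightarrow> (TN \<Rrightarrow> \<sigma> \<Rrightarrow> \<sigma>) \<Rrightarrow> TN \<Rrightarrow> \<sigma>"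
| "con_type TT = TB"
| "con_type FF = TB"
| "con_type (Cond \<sigma>) = TB \<Rrightarrow> \<sigma> \<Rrightarrow> \<sigma> \<Rrightarrow> \<sigma>"
| "con_type (SSing \<sigma>) = \<sigma> \<Rrightarrow> Star \<sigma>"
| "con_type (SUn \<sigma>) = Star \<sigma> \<Rrightarrow> Star \<sigma> \<Rrightarrow> Star \<sigma>"
| "con_type (SUnion \<rho> \<sigma>) = Star \<rho> \<Rrightarrow> (\<rho> \<Rrightarrow> Star \<sigma>) \<Rrightarrow> Star \<sigma>"
| "con_type (SMem \<sigma>) = \<sigma> \<Rrightarrow> Star \<sigma> \<Rrightarrow> TB"
| "con_type SMax = Star TN \<Rrightarrow> TN"

text \<open>Variables are de Bruijn indices; in a context \<open>\<Gamma>\<close> the variable \<open>Var i\<close> has type \<open>\<Gamma> ! i\<close>.\<close>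

datatype trm = Var nat | Con con | App trm trm (infixl "\<cdot>" 75)

text \<open>A set \<open>D\<close> of types determines the language whose constants have a type in \<open>D\<close> and whose
  quantifiers and equations range over types in \<open>D\<close>: \<open>Collect star_free\<close> gives the language of
  \<open>HA\<^sup>\<omega>\<close> and \<open>UNIV\<close> the target language.\<close>

inductive typed :: "ty set \<Rightarrow> ty list \<Rightarrow> trm \<Rightarrow> ty \<Rightarrow> bool" for D \<Gamma> where
  "i < length \<Gamma> \<Longrightarrow> typed D \<Gamma> (Var i) (\<Gamma> ! i)"
| "con_type c \<in> D \<Longrightarrow> typed D \<Gamma> (Con c) (con_type c)"
| "typed D \<Gamma> s (\<rho> \<Rrightarrow> \<sigma>) \<Longrightarrow> typed D \<Gamma> t \<rho> \<Longrightarrow> typed D \<Gamma> (s \<cdot> t) \<sigma>"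

datatype fm = Eq ty trm trm | Bot | And fm fm | Imp fm fm | All ty fm | Ex ty fm

primrec wf_fm :: "ty set \<Rightarrow> ty list \<Rightarrow> fm \<Rightarrow> bool" where
  "wf_fm D \<Gamma> (Eq \<sigma> s t) = (\<sigma> \<in> D \<and> typed D \<Gamma> s \<sigma> \<and> typed D \<Gamma> t \<sigma>)"
| "wf_fm D \<Gamma> Bot = True"
| "wf_fm D \<Gamma> (And \<phi> \<psi>) = (wf_fm D \<Gamma> \<phi> \<and> wf_fm D \<Gamma> \<psi>)"
| "wf_fm D \<Gamma> (Imp \<phi> \<psi>) = (wf_fm D \<Gamma> \<phi> \<and> wf_fm D \<Gamma> \<psi>)"
| "wf_fm D \<Gamma> (All \<sigma> \<phi>) = (\<sigma> \<in> D \<and> wf_fm D (\<sigma> # \<Gamma>) \<phi>)"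
| "wf_fm D \<Gamma> (Ex \<sigma> \<phi>) = (\<sigma> \<in> D \<and> wf_fm D (\<sigma> # \<Gamma>) \<phi>)"

abbreviation sentence :: "ty set \<Rightarrow> fm \<Rightarrow> bool" where
  "sentence D \<equiv> wf_fm D []"

primrec ren :: "(nat \<Rightarrow> nat) \<Rightarrow> trm \<Rightarrow> trm" where
  "ren r (Var i) = Var (r i)"
| "ren r (Con c) = Con c"
| "ren r (s \<cdot> t) = ren r s \<cdot> ren r t"

definition shift :: "nat \<Rightarrow> trm \<Rightarrow> trm" where
  "shift k = ren (\<lambda>i. i + k)"

definition apps :: "trm \<Rightarrow> trm list \<Rightarrow> trm" where
  "apps = foldl App"

text \<open>Formulas of \<open>HA\<^sup>\<omega>\<close> extended by the predicates \<open>\<I>\<^sub>\<sigma>\<close>, written \<open>IPred \<sigma>\<close>.\<close>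

datatype ifm = IEq ty trm trm | IBot | IAnd ifm ifm | IImp ifm ifm | IAll ty ifm | IEx ty ifm
  | IPred ty trm

primrec relativize :: "fm \<Rightarrow> ifm" where
  "relativize (Eq \<sigma> s t) = IEq \<sigma> s t"
| "relativize Bot = IBot"
| "relativize (And \<phi> \<psi>) = IAnd (relativize \<phi>) (relativize \<psi>)"
| "relativize (Imp \<phi> \<psi>) = IImp (relativize \<phi>) (relativize \<psi>)"
| "relativize (All \<sigma> \<phi>) = IAll \<sigma> (IImp (IPred \<sigma> (Var 0)) (relativize \<phi>))"
| "relativize (Ex \<sigma> \<phi>) = IEx \<sigma> (IAnd (IPred \<sigma> (Var 0)) (relativize \<phi>))"


section \<open>The structure \<open>\<S>\<^sup>\<omega>\<^sub>*\<close> and its theory\<close>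

text \<open>HOL does not provide a type containing all finite types over the natural numbers, so the
  structure is described up to isomorphism, over an arbitrary type \<open>'u\<close>: the sort \<open>\<sigma>\<close> is a set \<open>carr \<sigma>\<close>, whose elements represent natural numbers,
  truth values, functions and finite sets by means of \<open>num\<close>, \<open>tv\<close>, \<open>ap\<close> and \<open>elems\<close>.\<close>

record 'u struct =
  carr :: "ty \<Rightarrow> 'u set"
  num :: "nat \<Rightarrow> 'u"
  tv :: "bool \<Rightarrow> 'u"
  ap :: "'u \<Rightarrow> 'u \<Rightarrow> 'u"
  elems :: "'u \<Rightarrow> 'u set"

text \<open>\<open>S_omega_star D M\<close>: up to isomorphism, \<open>M\<close> is the restriction of \<open>\<S>\<^sup>\<omega>\<^sub>*\<close> to the sorts in \<open>D\<close>.
  The whole of \<open>\<S>\<^sup>\<omega>\<^sub>*\<close> is the case \<open>D = UNIV\<close>; whether some \<open>'u\<close> realizes it is not decided by HOL.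
  If \<open>D\<close> consists of the types up to a given level, then a suitable \<open>'u\<close> can be constructed, see
  \<open>S_omega_star_level_4_realizable\<close> below.\<close>

definition S_omega_star :: "ty set \<Rightarrow> 'u struct \<Rightarrow> bool" where
  "S_omega_star D M \<longleftrightarrow>
     subtype_closed D \<and>
     bij_betw (num M) UNIV (carr M TN) \<and>
     bij_betw (tv M) UNIV (carr M TB) \<and>
     (\<forall>\<rho> \<sigma>. \<rho> \<Rrightarrow> \<sigma> \<in> D \<longrightarrow>
        bij_betw (\<lambda>f. restrict (ap M f) (carr M \<rho>)) (carr M (\<rho> \<Rrightarrow> \<sigma>))
                 (carr M \<rho> \<rightarrow>\<^sub>E carr M \<sigma>)) \<and>
     (\<forall>\<sigma>. Star \<sigma> \<in> D \<longrightarrow>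
        bij_betw (elems M) (carr M (Star \<sigma>)) {X. X \<subseteq> carr M \<sigma> \<and> finite X \<and> X \<noteq> {}})"

definition nat_of :: "'u struct \<Rightarrow> 'u \<Rightarrow> nat" where
  "nat_of M x = (THE n. num M n = x)"

definition lam :: "'u struct \<Rightarrow> ty \<Rightarrow> ty \<Rightarrow> ('u \<Rightarrow> 'u) \<Rightarrow> 'u" where
  "lam M \<rho> \<sigma> F = (THE f. f \<in> carr M (\<rho> \<Rrightarrow> \<sigma>) \<and> (\<forall>x \<in> carr M \<rho>. ap M f x = F x))"

definition mkset :: "'u struct \<Rightarrow> ty \<Rightarrow> 'u set \<Rightarrow> 'u" where
  "mkset M \<sigma> X = (THE s. s \<in> carr M (Star \<sigma>) \<and> elems M s = X)"

primrec con_val :: "'u struct \<Rightarrow> con \<Rightarrow> 'u" where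
  "con_val M (CombK \<rho> \<sigma>) = lam M \<rho> (\<sigma> \<Rrightarrow> \<rho>) (\<lambda>x. lam M \<sigma> \<rho> (\<lambda>y. x))"
| "con_val M (CombS \<rho> \<sigma> \<tau>) =
     lam M (\<rho> \<Rrightarrow> \<sigma> \<Rrightarrow> \<tau>) ((\<rho> \<Rrightarrow> \<sigma>) \<Rrightarrow> \<rho> \<Rrightarrow> \<tau>) (\<lambda>f. lam M (\<rho> \<Rrightarrow> \<sigma>) (\<rho> \<Rrightarrow> \<tau>) (\<lambda>g.
       lam M \<rho> \<tau> (\<lambda>x. ap M (ap M f x) (ap M g x))))"
| "con_val M Zero = num M 0"
| "con_val M Succ = lam M TN TN (\<lambda>x. num M (Suc (nat_of M x)))"
| "con_val M (Rec \<sigma>) =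
     lam M \<sigma> ((TN \<Rrightarrow> \<sigma> \<Rrightarrow> \<sigma>) \<Rrightarrow> TN \<Rrightarrow> \<sigma>) (\<lambda>a. lam M (TN \<Rrightarrow> \<sigma> \<Rrightarrow> \<sigma>) (TN \<Rrightarrow> \<sigma>) (\<lambda>f.
       lam M TN \<sigma> (\<lambda>x. rec_nat a (\<lambda>n y. ap M (ap M f (num M n)) y) (nat_of M x))))"
| "con_val M TT = tv M True"
| "con_val M FF = tv M False"
| "con_val M (Cond \<sigma>) =
     lam M TB (\<sigma> \<Rrightarrow> \<sigma> \<Rrightarrow> \<sigma>) (\<lambda>b. lam M \<sigma> (\<sigma> \<Rrightarrow> \<sigma>) (\<lambda>x. lam M \<sigma> \<sigma> (\<lambda>y.
       if b = tv M True then x else y)))"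
| "con_val M (SSing \<sigma>) = lam M \<sigma> (Star \<sigma>) (\<lambda>x. mkset M \<sigma> {x})"
| "con_val M (SUn \<sigma>) =
     lam M (Star \<sigma>) (Star \<sigma> \<Rrightarrow> Star \<sigma>) (\<lambda>s. lam M (Star \<sigma>) (Star \<sigma>) (\<lambda>t.
       mkset M \<sigma> (elems M s \<union> elems M t)))"
| "con_val M (SUnion \<rho> \<sigma>) =
     lam M (Star \<rho>) ((\<rho> \<Rrightarrow> Star \<sigma>) \<Rrightarrow> Star \<sigma>) (\<lambda>t. lam M (\<rho> \<Rrightarrow> Star \<sigma>) (Star \<sigma>) (\<lambda>q.
       mkset M \<sigma> (\<Union>w \<in> elems M t. elems M (ap M q w))))"
| "con_val M (SMem \<sigma>) =
     lam M \<sigma> (Star \<sigma> \<Rrightarrow> TB) (\<lambda>x. lam M (Star \<sigma>) TB (\<lambda>s. tv M (x \<in> elems M s)))"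
| "con_val M SMax = lam M (Star TN) TN (\<lambda>s. num M (Max (nat_of M ` elems M s)))"

primrec eval :: "'u struct \<Rightarrow> 'u list \<Rightarrow> trm \<Rightarrow> 'u" where
  "eval M e (Var i) = e ! i"
| "eval M e (Con c) = con_val M c"
| "eval M e (s \<cdot> t) = ap M (eval M e s) (eval M e t)"

primrec sat :: "'u struct \<Rightarrow> 'u list \<Rightarrow> fm \<Rightarrow> bool" where
  "sat M e (Eq \<sigma> s t) \<longleftrightarrow> eval M e s = eval M e t"
| "sat M e Bot \<longleftrightarrow> False"
| "sat M e (And \<phi> \<psi>) \<longleftrightarrow> sat M e \<phi> \<and> sat M e \<psi>"
| "sat M e (Imp \<phi> \<psi>) \<longleftrightarrow> (sat M e \<phi> \<longrightarrow> sat M e \<psi>)"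
| "sat M e (All \<sigma> \<phi>) \<longleftrightarrow> (\<forall>x \<in> carr M \<sigma>. sat M (x # e) \<phi>)"
| "sat M e (Ex \<sigma> \<phi>) \<longleftrightarrow> (\<exists>x \<in> carr M \<sigma>. sat M (x # e) \<phi>)"

text \<open>A set of this form is closed under provability, so for it \<open>T \<turnstile> \<phi>\<close> is \<open>\<phi> \<in> T\<close>.\<close>

definition target_theory :: "ty set \<Rightarrow> 'u struct \<Rightarrow> fm set" where
  "target_theory D M = {\<phi>. sentence D \<phi> \<and> sat M [] \<phi>}"


section \<open>The interpretation\<close>

definition funs :: "ty list \<Rightarrow> ty \<Rightarrow> ty" where
  "funs \<rho>s \<sigma> = foldr Fun \<rho>s \<sigma>"

text \<open>\<open>bvars k\<close> are the variables bound by a block of \<open>k\<close> quantifiers, outermost first.\<close>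

definition bvars :: "nat \<Rightarrow> trm list" where
  "bvars k = map Var (rev [0..<k])"

definition alls :: "ty list \<Rightarrow> fm \<Rightarrow> fm" where
  "alls \<tau>s \<phi> = foldr All \<tau>s \<phi>"

text \<open>\<open>ball \<tau>s Bs \<phi>\<close> is \<open>\<forall>\<^bold>b \<in> \<^bold>B. \<phi>\<close>; here \<open>\<phi>\<close> lives under \<open>length \<tau>s\<close> additional binders, but the
  terms \<open>Bs\<close> do not.\<close>

fun ball :: "ty list \<Rightarrow> trm list \<Rightarrow> fm \<Rightarrow> fm" where
  "ball (\<tau> # \<tau>s) (B # Bs) \<phi> =
     All \<tau> (Imp (Eq TB (Con (SMem \<tau>) \<cdot> Var 0 \<cdot> shift 1 B) (Con TT))
                (ball \<tau>s (map (shift 1) Bs) \<phi>))"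
| "ball _ _ \<phi> = \<phi>"

text \<open>Types of the upper (witnesses) and lower (challenges) tuples in the clauses for \<open>\<I>\<^sub>\<sigma>\<close>. The
  predicates exist only for types of \<open>HA\<^sup>\<omega>\<close>; the value at starred types is irrelevant.\<close>

fun cp_wit :: "ty \<Rightarrow> ty list" and cp_chal :: "ty \<Rightarrow> ty list" where
  "cp_wit TN = [TN]"
| "cp_wit TB = [TB]"
| "cp_wit (\<rho> \<Rrightarrow> \<sigma>) =
     map (funs (cp_wit \<rho>)) (cp_wit \<sigma>) @
     map (\<lambda>\<tau>. funs (cp_wit \<rho> @ cp_chal \<sigma>) (Star \<tau>)) (cp_chal \<rho>)"
| "cp_wit (Star \<sigma>) = []"
| "cp_chal TN = []"
| "cp_chal TB = []"
| "cp_chal (\<rho> \<Rrightarrow> \<sigma>) = cp_wit \<rho> @ cp_chal \<sigma>"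
| "cp_chal (Star \<sigma>) = []"

text \<open>\<open>cp \<sigma> h us ls\<close> is the clause for \<open>\<I>\<^sub>\<sigma>(h)\<close> with upper tuple \<open>us\<close> and lower tuple \<open>ls\<close>. In the
  functional case \<open>us = fs @ gs\<close> and \<open>ls = as @ ds\<close>.\<close>

primrec cp :: "ty \<Rightarrow> trm \<Rightarrow> trm list \<Rightarrow> trm list \<Rightarrow> fm" where
  "cp TN h us ls = Eq TN h (hd us)"
| "cp TB h us ls = Eq TB h (hd us)"
| "cp (\<rho> \<Rrightarrow> \<sigma>) h us ls =
     (let fs = take (length (cp_wit \<sigma>)) us; gs = drop (length (cp_wit \<sigma>)) us;
          as = take (length (cp_wit \<rho>)) ls; ds = drop (length (cp_wit \<rho>)) ls;
          k = length (cp_chal \<rho>)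
      in All \<rho> (Imp
           (ball (cp_chal \<rho>) (map (\<lambda>g. shift 1 (apps g (as @ ds))) gs)
              (cp \<rho> (Var k) (map (shift (Suc k)) as) (bvars k)))
           (cp \<sigma> (shift 1 h \<cdot> Var 0) (map (\<lambda>f. shift 1 (apps f as)) fs) (map (shift 1) ds))))"
| "cp (Star \<sigma>) h us ls = Bot"

fun wit :: "ifm \<Rightarrow> ty list" and chal :: "ifm \<Rightarrow> ty list" where
  "wit (IEq \<sigma> s t) = []"
| "wit IBot = []"
| "wit (IAnd A B) = wit A @ wit B"
| "wit (IImp A B) =
     map (funs (wit A)) (wit B) @ map (\<lambda>\<tau>. funs (wit A @ chal B) (Star \<tau>)) (chal A)"
| "wit (IAll \<sigma> A) = wit A"
| "wit (IEx \<sigma> A) = wit A"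
| "wit (IPred \<sigma> t) = cp_wit \<sigma>"
| "chal (IEq \<sigma> s t) = []"
| "chal IBot = []"
| "chal (IAnd A B) = chal A @ chal B"
| "chal (IImp A B) = wit A @ chal B"
| "chal (IAll \<sigma> A) = chal A"
| "chal (IEx \<sigma> A) = map Star (chal A)"
| "chal (IPred \<sigma> t) = cp_chal \<sigma>"

text \<open>\<open>interp r A us ls\<close> is \<open>\<langle>A\<rangle>\<close> with upper tuple \<open>us\<close> and lower tuple \<open>ls\<close>. The renaming \<open>r\<close> sends
  the free variables of \<open>A\<close> to the variables denoting them in the context of \<open>us\<close> and \<open>ls\<close>, which
  contains further variables.\<close>

primrec interp :: "(nat \<Rightarrow> nat) \<Rightarrow> ifm \<Rightarrow> trm list \<Rightarrow> trm list \<Rightarrow> fm" where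
  "interp r (IEq \<sigma> s t) us ls = Eq \<sigma> (ren r s) (ren r t)"
| "interp r IBot us ls = Bot"
| "interp r (IAnd A B) us ls =
     And (interp r A (take (length (wit A)) us) (take (length (chal A)) ls))
         (interp r B (drop (length (wit A)) us) (drop (length (chal A)) ls))"
| "interp r (IImp A B) us ls =
     (let fs = take (length (wit B)) us; gs = drop (length (wit B)) us;
          as = take (length (wit A)) ls; ds = drop (length (wit A)) ls;
          k = length (chal A)
      in Imp
           (ball (chal A) (map (\<lambda>g. apps g (as @ ds)) gs)
              (interp (\<lambda>i. r i + k) A (map (shift k) as) (bvars k)))
           (interp r B (map (\<lambda>f. apps f as) fs) ds))"
| "interp r (IAll \<sigma> A) us ls =
     All \<sigma> (interp (case_nat 0 (Suc \<circ> r)) A (map (shift 1) us) (map (shift 1) ls))"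
| "interp r (IEx \<sigma> A) us ls =
     (let k = length (chal A)
      in Ex \<sigma> (ball (chal A) (map (shift 1) ls)
           (interp (\<lambda>i. case_nat 0 (Suc \<circ> r) i + k) A (map (shift (Suc k)) us) (bvars k))))"
| "interp r (IPred \<sigma> t) us ls = cp \<sigma> (ren r t) us ls"

text \<open>\<open>U_interpretable D T A\<close>, for a closed \<open>A\<close>: the witnessing terms are the terms of the target
  language restricted to the types in \<open>D\<close>.\<close>

definition U_interpretable :: "ty set \<Rightarrow> fm set \<Rightarrow> ifm \<Rightarrow> bool" where
  "U_interpretable D T A \<longleftrightarrow>
     (\<exists>ts. list_all2 (typed D []) ts (wit A) \<and>
           alls (chal A) (interp id A ts (bvars (length (chal A)))) \<in> T)"

definition Icp_interpretable :: "ty set \<Rightarrow> fm set \<Rightarrow> fm \<Rightarrow> bool" where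
  "Icp_interpretable D T A \<longleftrightarrow>
     sentence (Collect star_free) A \<and> U_interpretable D T (relativize A)"


section \<open>Pointwise continuity of type 2 functionals\<close>

text \<open>\<open>x \<le> y\<close> is \<open>x - y \<equiv> 0\<close> with truncated subtraction, defined by recursion from the predecessor:
  \<open>pred 0 = 0\<close>, \<open>pred (n+1) = n\<close>; \<open>x - 0 = x\<close>, \<open>x - (n+1) = pred (x - n)\<close>.\<close>

definition pred_trm :: trm where
  "pred_trm = Con (Rec TN) \<cdot> Con Zero \<cdot> Con (CombK TN TN)"

definition minus_trm :: "trm \<Rightarrow> trm \<Rightarrow> trm" where
  "minus_trm x y = Con (Rec TN) \<cdot> x \<cdot> (Con (CombK (TN \<Rrightarrow> TN) TN) \<cdot> pred_trm) \<cdot> y"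

definition le_fm :: "trm \<Rightarrow> trm \<Rightarrow> fm" where
  "le_fm x y = Eq TN (minus_trm x y) (Con Zero)"

text \<open>In the innermost scope \<open>\<Phi>, f, N, g, n\<close> are the variables \<open>4, 3, 2, 1, 0\<close>.\<close>

definition pointwise_continuity :: fm where
  "pointwise_continuity =
     All ((TN \<Rrightarrow> TN) \<Rrightarrow> TN) (All (TN \<Rrightarrow> TN) (Ex TN (All (TN \<Rrightarrow> TN)
       (Imp (All TN (Imp (le_fm (Var 0) (Var 2)) (Eq TN (Var 3 \<cdot> Var 0) (Var 1 \<cdot> Var 0))))
            (Eq TN (Var 3 \<cdot> Var 2) (Var 3 \<cdot> Var 0))))))"


section \<open>Realizability of the restrictions of \<open>\<S>\<^sup>\<omega>\<^sub>*\<close> to bounded levels\<close>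

text \<open>If \<open>S_omega_star D\<close> is realized over \<open>'u\<close>, then it is realized over \<open>'u val\<close> for the types
  all of whose argument types are in \<open>D\<close>. Iterating this reaches every level. We carry it out up to
  level 4.\<close>

datatype 'u val = VN nat | VB bool | VF ty "'u \<Rightarrow> 'u val" | VS "'u val fset"

primrec arg_types :: "ty \<Rightarrow> ty set" where
  "arg_types TN = {}"
| "arg_types TB = {}"
| "arg_types (\<rho> \<Rrightarrow> \<sigma>) = insert \<rho> (arg_types \<sigma>)"
| "arg_types (Star \<sigma>) = arg_types \<sigma>"

primrec vcarr :: "'u struct \<Rightarrow> ty \<Rightarrow> 'u val set" where
  "vcarr M TN = range VN"
| "vcarr M TB = range VB"
| "vcarr M (\<rho> \<Rrightarrow> \<sigma>) = VF \<rho> ` (carr M \<rho> \<rightarrow>\<^sub>E vcarr M \<sigma>)"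
| "vcarr M (Star \<sigma>) = VS ` {X. fset X \<subseteq> vcarr M \<sigma> \<and> X \<noteq> {||}}"

fun vn where "vn (VN n) = n" | "vn _ = undefined"
fun vb where "vb (VB b) = b" | "vb _ = undefined"
fun vf where "vf (VF \<rho> f) = f" | "vf _ = undefined"
fun vt where "vt (VF \<rho> f) = \<rho>" | "vt _ = undefined"
fun vs where "vs (VS X) = fset X" | "vs _ = undefined"

primrec lower :: "'u struct \<Rightarrow> ty \<Rightarrow> 'u val \<Rightarrow> 'u" where
  "lower M TN v = num M (vn v)"
| "lower M TB v = tv M (vb v)"
| "lower M (\<rho> \<Rrightarrow> \<sigma>) v =
     inv_into (carr M (\<rho> \<Rrightarrow> \<sigma>)) (\<lambda>f. restrict (ap M f) (carr M \<rho>))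
       (restrict (\<lambda>x. lower M \<sigma> (vf v x)) (carr M \<rho>))"
| "lower M (Star \<sigma>) v = inv_into (carr M (Star \<sigma>)) (elems M) (lower M \<sigma> ` vs v)"

definition lift_struct :: "'u struct \<Rightarrow> 'u val struct" where
  "lift_struct M = \<lparr> carr = vcarr M, num = VN, tv = VB,
     ap = (\<lambda>v w. vf v (lower M (vt v) w)), elems = vs \<rparr>"

lemma subtype_closedD:
  assumes "S_omega_star D M"
  shows "\<rho> \<Rrightarrow> \<sigma> \<in> D \<Longrightarrow> \<rho> \<in> D" and "\<rho> \<Rrightarrow> \<sigma> \<in> D \<Longrightarrow> \<sigma> \<in> D" and "Star \<sigma> \<in> D \<Longrightarrow> \<sigma> \<in> D"
  using assms unfolding S_omega_star_def subtype_closed_def by blast+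

lemma bij_betw_PiE_compose:
  assumes "bij_betw h A B"
  shows "bij_betw (\<lambda>f. restrict (\<lambda>x. f (h x)) A) (B \<rightarrow>\<^sub>E C) (A \<rightarrow>\<^sub>E C)"
proof (rule bij_betw_byWitness[where f' = "\<lambda>f. restrict (\<lambda>y. f (inv_into A h y)) B"])
  have hB: "h x \<in> B" if "x \<in> A" for x
    using assms that by (auto simp: bij_betw_def)
  have iA: "inv_into A h y \<in> A" if "y \<in> B" for y
    using assms that by (metis bij_betw_imp_surj_on inv_into_into)
  show "\<forall>f\<in>B \<rightarrow>\<^sub>E C. restrict (\<lambda>y. restrict (\<lambda>x. f (h x)) A (inv_into A h y)) B = f"
  proof
    fix f assume f: "f \<in> B \<rightarrow>\<^sub>E C"
    show "restrict (\<lambda>y. restrict (\<lambda>x. f (h x)) A (inv_into A h y)) B = f"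
    proof
      fix y show "restrict (\<lambda>y. restrict (\<lambda>x. f (h x)) A (inv_into A h y)) B y = f y"
        using f iA assms by (auto simp: restrict_def bij_betw_inv_into_right)
    qed
  qed
  show "\<forall>f\<in>A \<rightarrow>\<^sub>E C. restrict (\<lambda>x. restrict (\<lambda>y. f (inv_into A h y)) B (h x)) A = f"
  proof
    fix f assume f: "f \<in> A \<rightarrow>\<^sub>E C"
    show "restrict (\<lambda>x. restrict (\<lambda>y. f (inv_into A h y)) B (h x)) A = f"
    proof
      fix x show "restrict (\<lambda>x. restrict (\<lambda>y. f (inv_into A h y)) B (h x)) A x = f x"
        using f hB assms by (auto simp: restrict_def bij_betw_inv_into_left)
    qed
  qed
  show "(\<lambda>f. restrict (\<lambda>x. f (h x)) A) ` (B \<rightarrow>\<^sub>E C) \<subseteq> A \<rightarrow>\<^sub>E C"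
    using hB by (auto simp: PiE_iff)
  show "(\<lambda>f. restrict (\<lambda>y. f (inv_into A h y)) B) ` (A \<rightarrow>\<^sub>E C) \<subseteq> B \<rightarrow>\<^sub>E C"
    using iA by (auto simp: PiE_iff)
qed

lemma bij_betw_PiE_post:
  assumes "bij_betw h B C"
  shows "bij_betw (\<lambda>f. restrict (\<lambda>x. h (f x)) A) (A \<rightarrow>\<^sub>E B) (A \<rightarrow>\<^sub>E C)"
proof (rule bij_betw_byWitness[where f' = "\<lambda>f. restrict (\<lambda>x. inv_into B h (f x)) A"])
  have hC: "h x \<in> C" if "x \<in> B" for x
    using assms that by (auto simp: bij_betw_def)
  have iB: "inv_into B h y \<in> B" if "y \<in> C" for y
    using assms that by (metis bij_betw_imp_surj_on inv_into_into)
  show "\<forall>f\<in>A \<rightarrow>\<^sub>E B. restrict (\<lambda>x. inv_into B h (restrict (\<lambda>x. h (f x)) A x)) A = f"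
  proof
    fix f assume f: "f \<in> A \<rightarrow>\<^sub>E B"
    show "restrict (\<lambda>x. inv_into B h (restrict (\<lambda>x. h (f x)) A x)) A = f"
    proof
      fix y show "restrict (\<lambda>x. inv_into B h (restrict (\<lambda>x. h (f x)) A x)) A y = f y"
        using bij_betw_inv_into_left[OF assms PiE_mem[OF f, of y]] f by (auto simp: restrict_def)
    qed
  qed
  show "\<forall>f\<in>A \<rightarrow>\<^sub>E C. restrict (\<lambda>x. h (restrict (\<lambda>x. inv_into B h (f x)) A x)) A = f"
  proof
    fix f assume f: "f \<in> A \<rightarrow>\<^sub>E C"
    show "restrict (\<lambda>x. h (restrict (\<lambda>x. inv_into B h (f x)) A x)) A = f"
    proof
      fix y show "restrict (\<lambda>x. h (restrict (\<lambda>x. inv_into B h (f x)) A x)) A y = f y"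
        using bij_betw_inv_into_right[OF assms PiE_mem[OF f, of y]] f by (auto simp: restrict_def)
    qed
  qed
  show "(\<lambda>f. restrict (\<lambda>x. h (f x)) A) ` (A \<rightarrow>\<^sub>E B) \<subseteq> A \<rightarrow>\<^sub>E C"
    using hC by (auto simp: PiE_iff)
  show "(\<lambda>f. restrict (\<lambda>x. inv_into B h (f x)) A) ` (A \<rightarrow>\<^sub>E C) \<subseteq> A \<rightarrow>\<^sub>E B"
    using iB by (auto simp: PiE_iff)
qed

lemma bij_betw_vs:
  "bij_betw vs (VS ` {X. fset X \<subseteq> A \<and> X \<noteq> {||}}) {X. X \<subseteq> A \<and> finite X \<and> X \<noteq> {}}"
proof -
  have ne: "fset X \<noteq> {} \<longleftrightarrow> X \<noteq> {||}" for X :: "'a val fset"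
    by (metis bot_fset.rep_eq fset_inject)
  have "X \<in> vs ` VS ` {X. fset X \<subseteq> A \<and> X \<noteq> {||}}"
    if "X \<subseteq> A" "finite X" "X \<noteq> {}" for X
  proof -
    have "fset (Abs_fset X) = X" using that by (simp add: Abs_fset_inverse)
    with that ne[of "Abs_fset X"] show ?thesis
      by (intro image_eqI[where x = "VS (Abs_fset X)"]) auto
  qed
  then have "vs ` VS ` {X. fset X \<subseteq> A \<and> X \<noteq> {||}} = {X. X \<subseteq> A \<and> finite X \<and> X \<noteq> {}}"
    by (auto simp: ne)
  moreover have "inj_on vs (VS ` {X. fset X \<subseteq> A \<and> X \<noteq> {||}})"
    by (auto simp: inj_on_def fset_inject)
  ultimately show ?thesis by (simp add: bij_betw_def)
qed

lemma bij_betw_image_fin: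
  assumes "bij_betw h A B"
  shows "bij_betw ((`) h) {X. X \<subseteq> A \<and> finite X \<and> X \<noteq> {}} {X. X \<subseteq> B \<and> finite X \<and> X \<noteq> {}}"
proof (rule bij_betw_byWitness[where f' = "(`) (inv_into A h)"])
  have B: "B = h ` A" and i: "inj_on h A" using assms by (auto simp: bij_betw_def)
  show "\<forall>X\<in>{X. X \<subseteq> A \<and> finite X \<and> X \<noteq> {}}. inv_into A h ` h ` X = X"
    using i by (simp add: inv_into_image_cancel)
  show "\<forall>X\<in>{X. X \<subseteq> B \<and> finite X \<and> X \<noteq> {}}. h ` inv_into A h ` X = X"
    using B by (auto simp: image_inv_into_cancel)
  show "(`) h ` {X. X \<subseteq> A \<and> finite X \<and> X \<noteq> {}} \<subseteq> {X. X \<subseteq> B \<and> finite X \<and> X \<noteq> {}}"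
    using B by auto
  show "(`) (inv_into A h) ` {X. X \<subseteq> B \<and> finite X \<and> X \<noteq> {}} \<subseteq> {X. X \<subseteq> A \<and> finite X \<and> X \<noteq> {}}"
    using B by (auto intro: inv_into_into)
qed

lemma bij_betw_lower:
  fixes M :: "'u struct"
  assumes M: "S_omega_star D M" and "\<sigma> \<in> D"
  shows "bij_betw (lower M \<sigma>) (vcarr M \<sigma>) (carr M \<sigma>)"
  using \<open>\<sigma> \<in> D\<close>
proof (induction \<sigma>)
  case TN
  have "bij_betw vn (range (VN :: _ \<Rightarrow> 'u val)) UNIV"
    by (rule bij_betw_byWitness[where f' = VN]) auto
  from bij_betw_trans[OF this, of "num M" "carr M TN"] M
  have "bij_betw (num M \<circ> vn) (vcarr M TN) (carr M TN)"
    by (simp add: S_omega_star_def)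
  then show ?case by (rule bij_betw_cong[THEN iffD1, rotated]) auto
next
  case TB
  have "bij_betw vb (range (VB :: _ \<Rightarrow> 'u val)) UNIV"
    by (rule bij_betw_byWitness[where f' = VB]) auto
  from bij_betw_trans[OF this, of "tv M" "carr M TB"] M
  have "bij_betw (tv M \<circ> vb) (vcarr M TB) (carr M TB)"
    by (simp add: S_omega_star_def)
  then show ?case by (rule bij_betw_cong[THEN iffD1, rotated]) auto
next
  case (Fun \<rho> \<sigma>)
  have "\<sigma> \<in> D" using subtype_closedD[OF M] Fun.prems by blast
  with Fun.IH have 1: "bij_betw (\<lambda>f. restrict (\<lambda>x. lower M \<sigma> (f x)) (carr M \<rho>))
      (carr M \<rho> \<rightarrow>\<^sub>E vcarr M \<sigma>) (carr M \<rho> \<rightarrow>\<^sub>E carr M \<sigma>)"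
    by (intro bij_betw_PiE_post) auto
  have 2: "bij_betw (inv_into (carr M (\<rho> \<Rrightarrow> \<sigma>)) (\<lambda>f. restrict (ap M f) (carr M \<rho>)))
      (carr M \<rho> \<rightarrow>\<^sub>E carr M \<sigma>) (carr M (\<rho> \<Rrightarrow> \<sigma>))"
    using M Fun.prems by (intro bij_betw_inv_into) (simp add: S_omega_star_def)
  have 3: "bij_betw vf (vcarr M (\<rho> \<Rrightarrow> \<sigma>)) (carr M \<rho> \<rightarrow>\<^sub>E vcarr M \<sigma>)"
    by (rule bij_betw_byWitness[where f' = "VF \<rho>"]) auto
  show ?case
    using bij_betw_trans[OF 3 bij_betw_trans[OF 1 2]]
    by (rule bij_betw_cong[THEN iffD1, rotated]) (simp only: o_apply lower.simps)
next
  case (Star \<sigma>)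
  have "\<sigma> \<in> D" using subtype_closedD[OF M] Star.prems by blast
  note 1 = bij_betw_image_fin[OF Star.IH[OF this]]
  have 2: "bij_betw (inv_into (carr M (Star \<sigma>)) (elems M))
      {X. X \<subseteq> carr M \<sigma> \<and> finite X \<and> X \<noteq> {}} (carr M (Star \<sigma>))"
    using M Star.prems by (intro bij_betw_inv_into) (simp add: S_omega_star_def)
  have 3: "bij_betw vs (vcarr M (Star \<sigma>)) {X. X \<subseteq> vcarr M \<sigma> \<and> finite X \<and> X \<noteq> {}}"
    using bij_betw_vs by simp
  show ?case
    using bij_betw_trans[OF 3 bij_betw_trans[OF 1 2]]
    by (rule bij_betw_cong[THEN iffD1, rotated]) (simp only: o_apply lower.simps)
qed

lemma S_omega_star_lift:
  assumes M: "S_omega_star D M"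
  shows "S_omega_star {\<sigma>. arg_types \<sigma> \<subseteq> D} (lift_struct M)"
proof -
  note D = subtype_closedD[OF M]
  have args: "arg_types \<sigma> \<subseteq> D" if "\<sigma> \<in> D" for \<sigma>
    using that
  proof (induction \<sigma>)
    case (Fun \<rho> \<sigma>)
    then show ?case using D(1,2)[OF Fun.prems] by simp
  next
    case (Star \<sigma>)
    then show ?case using D(3)[OF Star.prems] by simp
  qed auto
  have "subtype_closed {\<sigma>. arg_types \<sigma> \<subseteq> D}"
    using args by (auto simp: subtype_closed_def)
  moreover have "bij_betw (\<lambda>f. restrict (\<lambda>w. vf f (lower M (vt f) w)) (vcarr M \<rho>))
      (vcarr M (\<rho> \<Rrightarrow> \<sigma>)) (vcarr M \<rho> \<rightarrow>\<^sub>E vcarr M \<sigma>)" if "\<rho> \<in> D" for \<rho> \<sigma>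
  proof -
    have 1: "bij_betw vf (vcarr M (\<rho> \<Rrightarrow> \<sigma>)) (carr M \<rho> \<rightarrow>\<^sub>E vcarr M \<sigma>)"
      by (rule bij_betw_byWitness[where f' = "VF \<rho>"]) auto
    have "bij_betw (\<lambda>f. restrict (\<lambda>w. vf f (lower M \<rho> w)) (vcarr M \<rho>))
        (vcarr M (\<rho> \<Rrightarrow> \<sigma>)) (vcarr M \<rho> \<rightarrow>\<^sub>E vcarr M \<sigma>)"
      using bij_betw_trans[OF 1 bij_betw_PiE_compose[OF bij_betw_lower[OF M that]]]
      by (simp add: o_def)
    then show ?thesis
      by (rule bij_betw_cong[THEN iffD1, rotated]) auto
  qed
  moreover have "bij_betw vs (vcarr M (Star \<sigma>)) {X. X \<subseteq> vcarr M \<sigma> \<and> finite X \<and> X \<noteq> {}}" for \<sigma>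
    using bij_betw_vs by simp
  moreover have "bij_betw VN UNIV (vcarr M TN)" "bij_betw VB UNIV (vcarr M TB)"
    by (auto simp: bij_betw_def inj_on_def)
  ultimately show ?thesis
    by (simp add: S_omega_star_def lift_struct_def del: vcarr.simps)
qed

lemma level_le_lift:
  "{\<sigma>. level \<sigma> \<le> n} \<subseteq> D \<Longrightarrow> {\<sigma>. level \<sigma> \<le> Suc n} \<subseteq> {\<sigma>. arg_types \<sigma> \<subseteq> D}"
proof
  fix \<sigma> assume "{\<sigma>. level \<sigma> \<le> n} \<subseteq> D" "\<sigma> \<in> {\<sigma>. level \<sigma> \<le> Suc n}"
  then show "\<sigma> \<in> {\<sigma>. arg_types \<sigma> \<subseteq> D}" by (induction \<sigma>) auto
qed

lemma S_omega_star_level_4_realizable: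
  "\<exists>D (M :: (nat + bool) val val val val val struct). S_omega_star D M \<and> {\<sigma>. level \<sigma> \<le> 4} \<subseteq> D"
proof -
  define M :: "(nat + bool) struct" where
    "M = \<lparr> carr = (\<lambda>\<sigma>. if \<sigma> = TN then range Inl else range Inr), num = Inl, tv = Inr,
           ap = undefined, elems = undefined \<rparr>"
  have 0: "S_omega_star {TN, TB} M"
    by (auto simp: S_omega_star_def subtype_closed_def M_def bij_betw_def)
  have "arg_types \<sigma> \<subseteq> {TN, TB}" if "level \<sigma> = 0" for \<sigma>
    using that by (induction \<sigma>) auto
  then have l: "{\<sigma>. level \<sigma> \<le> 0} \<subseteq> {\<sigma>. arg_types \<sigma> \<subseteq> {TN, TB}}"
    by auto
  have "{\<sigma>. level \<sigma> \<le> 4} \<subseteq> {\<sigma>. arg_types \<sigma> \<subseteq> {\<sigma>. arg_types \<sigma> \<subseteq> {\<sigma>. arg_types \<sigma> \<subseteq>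
      {\<sigma>. arg_types \<sigma> \<subseteq> {\<sigma>. arg_types \<sigma> \<subseteq> {TN, TB}}}}}}"
    using level_le_lift[OF level_le_lift[OF level_le_lift[OF level_le_lift[OF l]]]]
    by (simp add: eval_nat_numeral)
  with S_omega_star_lift[OF S_omega_star_lift[OF S_omega_star_lift[OF S_omega_star_lift[OF
      S_omega_star_lift[OF 0]]]]]
  show ?thesis by (intro exI conjI)
qed

end

theory Submission
  imports Defs
begin

text \<open>Given \<open>\<Psi>\<close> and \<open>\<mu>\<close> witnessing \<open>\<I>(\<Phi>)\<close> and \<open>h\<close> witnessing \<open>\<I>(f)\<close>, the finite set \<open>\<mu> h\<close> is a
  modulus of continuity at \<open>h\<close>: every \<open>x\<close> that agrees with \<open>h\<close> on \<open>\<mu> h\<close> satisfies \<open>\<Phi> x = \<Psi> h\<close>. So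
  \<open>N\<close> is taken to be the maximum of \<open>\<mu> h\<close>, the hypotheses on \<open>f\<close>, on \<open>g\<close> and on their agreement are
  called at the elements of \<open>\<mu> h\<close>, and the hypothesis on \<open>\<Phi>\<close> only at \<open>h\<close>. Then \<open>f\<close> and \<open>g\<close> both
  agree with \<open>h\<close> on \<open>\<mu> h\<close>, whence \<open>\<Phi> f = \<Psi> h = \<Phi> g\<close>.\<close>

section \<open>Functions, finite sets and constants in the full structure\<close>

locale set_structure =
  fixes M :: "'u struct" and D :: "ty set"
  assumes M: "S_omega_star D M"
begin

lemmas subtype_D = subtype_closedD[OF M]

text \<open>Surjectivity of the coding of functions yields an element that acts as \<open>F\<close>,
  and injectivity makes it unique, so the definite description in \<open>lam\<close>
  denotes.\<close>

lemma lam: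
  assumes "\<rho> \<Rrightarrow> \<sigma> \<in> D" and "\<And>x. x \<in> carr M \<rho> \<Longrightarrow> F x \<in> carr M \<sigma>"
  shows lam_carr: "lam M \<rho> \<sigma> F \<in> carr M (\<rho> \<Rrightarrow> \<sigma>)"
    and ap_lam: "x \<in> carr M \<rho> \<Longrightarrow> ap M (lam M \<rho> \<sigma> F) x = F x"
proof -
  have bij: "bij_betw (\<lambda>f. restrict (ap M f) (carr M \<rho>)) (carr M (\<rho> \<Rrightarrow> \<sigma>))
      (carr M \<rho> \<rightarrow>\<^sub>E carr M \<sigma>)"
    using M assms(1) by (simp add: S_omega_star_def)
  have "restrict F (carr M \<rho>) \<in> carr M \<rho> \<rightarrow>\<^sub>E carr M \<sigma>"
    using assms(2) by auto
  with bij obtain f where f: "f \<in> carr M (\<rho> \<Rrightarrow> \<sigma>)"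
      "restrict (ap M f) (carr M \<rho>) = restrict F (carr M \<rho>)"
    unfolding bij_betw_def by (metis (no_types, lifting) imageE)
  have "\<exists>!f. f \<in> carr M (\<rho> \<Rrightarrow> \<sigma>) \<and> (\<forall>x\<in>carr M \<rho>. ap M f x = F x)"
  proof (rule ex1I[of _ f])
    show "f \<in> carr M (\<rho> \<Rrightarrow> \<sigma>) \<and> (\<forall>x\<in>carr M \<rho>. ap M f x = F x)"
      using f by (metis restrict_apply')
    fix g assume "g \<in> carr M (\<rho> \<Rrightarrow> \<sigma>) \<and> (\<forall>x\<in>carr M \<rho>. ap M g x = F x)"
    with f have "g \<in> carr M (\<rho> \<Rrightarrow> \<sigma>)"
      "restrict (ap M g) (carr M \<rho>) = restrict (ap M f) (carr M \<rho>)"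
      by (auto simp: restrict_def)
    with f(1) show "g = f"
      using inj_onD[OF bij_betw_imp_inj_on[OF bij]] by blast
  qed
  from theI'[OF this] show "lam M \<rho> \<sigma> F \<in> carr M (\<rho> \<Rrightarrow> \<sigma>)"
    and "x \<in> carr M \<rho> \<Longrightarrow> ap M (lam M \<rho> \<sigma> F) x = F x"
    by (auto simp: lam_def)
qed

lemma ap_carr:
  assumes "\<rho> \<Rrightarrow> \<sigma> \<in> D" "f \<in> carr M (\<rho> \<Rrightarrow> \<sigma>)" "x \<in> carr M \<rho>"
  shows "ap M f x \<in> carr M \<sigma>"
proof -
  have "restrict (ap M f) (carr M \<rho>) \<in> carr M \<rho> \<rightarrow>\<^sub>E carr M \<sigma>"
    using M assms(1,2) unfolding S_omega_star_def bij_betw_def by blast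
  then show ?thesis using assms(3) by (metis PiE_mem restrict_apply')
qed

lemma elems_carr:
  assumes "Star \<sigma> \<in> D" "s \<in> carr M (Star \<sigma>)"
  shows "elems M s \<subseteq> carr M \<sigma>" "finite (elems M s)" "elems M s \<noteq> {}"
proof -
  have "elems M ` carr M (Star \<sigma>) = {X. X \<subseteq> carr M \<sigma> \<and> finite X \<and> X \<noteq> {}}"
    using M assms(1) by (simp add: S_omega_star_def bij_betw_def)
  with assms(2) show "elems M s \<subseteq> carr M \<sigma>" "finite (elems M s)" "elems M s \<noteq> {}"
    by blast+
qed

lemma mkset:
  assumes "Star \<sigma> \<in> D" "X \<subseteq> carr M \<sigma>" "finite X" "X \<noteq> {}"
  shows mkset_carr: "mkset M \<sigma> X \<in> carr M (Star \<sigma>)" and elems_mkset: "elems M (mkset M \<sigma> X) = X"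
proof -
  have "bij_betw (elems M) (carr M (Star \<sigma>)) {X. X \<subseteq> carr M \<sigma> \<and> finite X \<and> X \<noteq> {}}"
    using M assms(1) by (simp add: S_omega_star_def)
  then have "\<exists>!s. s \<in> carr M (Star \<sigma>) \<and> elems M s = X"
    using assms(2-) unfolding bij_betw_def inj_on_def by (smt (verit) imageE mem_Collect_eq)
  from theI'[OF this] show "mkset M \<sigma> X \<in> carr M (Star \<sigma>)" "elems M (mkset M \<sigma> X) = X"
    by (auto simp: mkset_def)
qed

lemma carr_TN: "carr M TN = range (num M)" and num_eq_iff [simp]: "num M m = num M n \<longleftrightarrow> m = n"
  and carr_TB: "carr M TB = range (tv M)" and tv_eq_iff [simp]: "tv M a = tv M b \<longleftrightarrow> a = b"
  using M by (auto simp: S_omega_star_def bij_betw_def inj_on_def)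

lemma nat_of_num [simp]: "nat_of M (num M n) = n"
  by (auto simp: nat_of_def)

lemma num_carr [simp]: "num M n \<in> carr M TN" and tv_carr [simp]: "tv M b \<in> carr M TB"
  by (auto simp: carr_TN carr_TB)

text \<open>This and the following rules compute with the constants while \<open>con_val\<close>
  stays folded, so that nested \<open>lam\<close> expressions do not reappear in later
  simplifications; they only ask that arguments lie in the right carriers.\<close>

lemma CombK:
  assumes "con_type (CombK \<rho> \<sigma>) \<in> D"
  shows K_carr: "con_val M (CombK \<rho> \<sigma>) \<in> carr M (\<rho> \<Rrightarrow> \<sigma> \<Rrightarrow> \<rho>)"
    and ap_K: "x \<in> carr M \<rho> \<Longrightarrow> ap M (con_val M (CombK \<rho> \<sigma>)) x \<in> carr M (\<sigma> \<Rrightarrow> \<rho>)"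
      "x \<in> carr M \<rho> \<Longrightarrow> y \<in> carr M \<sigma> \<Longrightarrow> ap M (ap M (con_val M (CombK \<rho> \<sigma>)) x) y = x"
  using assms subtype_D(2)[of \<rho> "\<sigma> \<Rrightarrow> \<rho>"] by (auto simp: lam_carr ap_lam)

lemma CombS:
  assumes "con_type (CombS \<rho> \<sigma> \<tau>) \<in> D" "f \<in> carr M (\<rho> \<Rrightarrow> \<sigma> \<Rrightarrow> \<tau>)"
  shows ap_S_carr:
      "ap M (con_val M (CombS \<rho> \<sigma> \<tau>)) f \<in> carr M ((\<rho> \<Rrightarrow> \<sigma>) \<Rrightarrow> \<rho> \<Rrightarrow> \<tau>)"
      "g \<in> carr M (\<rho> \<Rrightarrow> \<sigma>) \<Longrightarrow> ap M (ap M (con_val M (CombS \<rho> \<sigma> \<tau>)) f) g \<in> carr M (\<rho> \<Rrightarrow> \<tau>)"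
    and ap_S: "g \<in> carr M (\<rho> \<Rrightarrow> \<sigma>) \<Longrightarrow> x \<in> carr M \<rho> \<Longrightarrow>
      ap M (ap M (ap M (con_val M (CombS \<rho> \<sigma> \<tau>)) f) g) x = ap M (ap M f x) (ap M g x)"
proof -
  have d: "(\<rho> \<Rrightarrow> \<sigma>) \<Rrightarrow> \<rho> \<Rrightarrow> \<tau> \<in> D" "\<rho> \<Rrightarrow> \<sigma> \<Rrightarrow> \<tau> \<in> D" "\<rho> \<Rrightarrow> \<tau> \<in> D" "\<rho> \<Rrightarrow> \<sigma> \<in> D" "\<sigma> \<Rrightarrow> \<tau> \<in> D"
    using assms(1) subtype_D by (metis con_type.simps(2))+
  \<comment> \<open>\<open>f\<close> is bound afresh: each nested \<open>lam\<close> needs its body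
    to stay in the carrier for all arguments, not only for the \<open>f\<close> of the
    statement.\<close>
  have c: "ap M (ap M f x) (ap M g x) \<in> carr M \<tau>"
    if "f \<in> carr M (\<rho> \<Rrightarrow> \<sigma> \<Rrightarrow> \<tau>)" "g \<in> carr M (\<rho> \<Rrightarrow> \<sigma>)" "x \<in> carr M \<rho>" for f g x
    using that d by (blast intro: ap_carr)
  show "ap M (con_val M (CombS \<rho> \<sigma> \<tau>)) f \<in> carr M ((\<rho> \<Rrightarrow> \<sigma>) \<Rrightarrow> \<rho> \<Rrightarrow> \<tau>)"
    "g \<in> carr M (\<rho> \<Rrightarrow> \<sigma>) \<Longrightarrow> ap M (ap M (con_val M (CombS \<rho> \<sigma> \<tau>)) f) g \<in> carr M (\<rho> \<Rrightarrow> \<tau>)"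
    "g \<in> carr M (\<rho> \<Rrightarrow> \<sigma>) \<Longrightarrow> x \<in> carr M \<rho> \<Longrightarrow>
      ap M (ap M (ap M (con_val M (CombS \<rho> \<sigma> \<tau>)) f) g) x = ap M (ap M f x) (ap M g x)"
    using assms d c by (simp_all add: lam_carr ap_lam)
qed

lemma SSing:
  assumes "con_type (SSing \<sigma>) \<in> D"
  shows SSing_carr: "con_val M (SSing \<sigma>) \<in> carr M (\<sigma> \<Rrightarrow> Star \<sigma>)"
    and elems_SSing: "x \<in> carr M \<sigma> \<Longrightarrow> elems M (ap M (con_val M (SSing \<sigma>)) x) = {x}"
  using assms subtype_D(2)[of \<sigma> "Star \<sigma>"] by (auto simp: lam_carr ap_lam mkset_carr elems_mkset)

lemma ap_SMem:
  assumes "con_type (SMem \<sigma>) \<in> D" "x \<in> carr M \<sigma>" "s \<in> carr M (Star \<sigma>)"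
  shows "ap M (ap M (con_val M (SMem \<sigma>)) x) s = tv M (x \<in> elems M s)"
  using assms subtype_D(2)[of \<sigma> "Star \<sigma> \<Rrightarrow> TB"] by (simp add: lam_carr ap_lam)

lemma SMax:
  assumes "con_type SMax \<in> D"
  shows SMax_carr: "con_val M SMax \<in> carr M (Star TN \<Rrightarrow> TN)"
    and ap_SMax: "s \<in> carr M (Star TN) \<Longrightarrow> ap M (con_val M SMax) s = num M (Max (nat_of M ` elems M s))"
  using assms by (auto simp: lam_carr ap_lam)

lemma Rec:
  assumes "con_type (Rec \<sigma>) \<in> D" "a \<in> carr M \<sigma>" "f \<in> carr M (TN \<Rrightarrow> \<sigma> \<Rrightarrow> \<sigma>)"
  shows ap_Rec_carr: "ap M (ap M (con_val M (Rec \<sigma>)) a) f \<in> carr M (TN \<Rrightarrow> \<sigma>)"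
    and ap_Rec: "ap M (ap M (ap M (con_val M (Rec \<sigma>)) a) f) (num M n) =
      rec_nat a (\<lambda>n y. ap M (ap M f (num M n)) y) n"
proof -
  have d: "(TN \<Rrightarrow> \<sigma> \<Rrightarrow> \<sigma>) \<Rrightarrow> TN \<Rrightarrow> \<sigma> \<in> D" "TN \<Rrightarrow> \<sigma> \<Rrightarrow> \<sigma> \<in> D" "TN \<Rrightarrow> \<sigma> \<in> D" "\<sigma> \<Rrightarrow> \<sigma> \<in> D"
    using assms(1) subtype_D by (metis con_type.simps(5))+
  have c: "rec_nat a (\<lambda>n y. ap M (ap M f (num M n)) y) n \<in> carr M \<sigma>"
    if "a \<in> carr M \<sigma>" "f \<in> carr M (TN \<Rrightarrow> \<sigma> \<Rrightarrow> \<sigma>)" for a f n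
    using that by (induction n) (simp_all add: ap_carr[OF d(4)] ap_carr[OF d(2)])
  show "ap M (ap M (con_val M (Rec \<sigma>)) a) f \<in> carr M (TN \<Rrightarrow> \<sigma>)"
    "ap M (ap M (ap M (con_val M (Rec \<sigma>)) a) f) (num M n) =
      rec_nat a (\<lambda>n y. ap M (ap M f (num M n)) y) n"
    using assms d c by (simp_all add: lam_carr ap_lam)
qed

lemma eval_minus_trm:
  assumes D: "{con_type (Rec TN), con_type (CombK TN TN), con_type (CombK (TN \<Rrightarrow> TN) TN)} \<subseteq> D"
    and "eval M e x \<in> carr M TN" "eval M e y \<in> carr M TN"
  shows "eval M e (minus_trm x y) = num M (nat_of M (eval M e x) - nat_of M (eval M e y))"
proof -
  obtain a b where ab: "eval M e x = num M a" "eval M e y = num M b"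
    using assms by (auto simp: carr_TN)
  \<comment> \<open>With \<open>CombK\<close> as step function the recursion returns the counter and
    forgets the previous value, which gives the predecessor, with value 0 at 0.\<close>
  have "rec_nat (num M 0) (\<lambda>n y. ap M (ap M (con_val M (CombK TN TN)) (num M n)) y) n
      = num M (n - 1)" for n
    using D by (induction n) (simp_all add: ap_K del: con_val.simps)
  then have pred: "eval M e pred_trm \<in> carr M (TN \<Rrightarrow> TN)"
    "ap M (eval M e pred_trm) (num M n) = num M (n - 1)" for n
    using D K_carr[of TN TN]
    by (simp_all add: pred_trm_def ap_Rec ap_Rec_carr del: con_val.simps(1,2,4-))
  \<comment> \<open>Here \<open>CombK\<close> discards the counter instead, so the predecessor is
    iterated \<open>b\<close> times.\<close>
  have "rec_nat (num M a) (\<lambda>n y. ap M (ap M (ap M (con_val M (CombK (TN \<Rrightarrow> TN) TN))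
      (eval M e pred_trm)) (num M n)) y) b = num M (a - b)"
    using D pred by (induction b) (simp_all add: ap_K del: con_val.simps)
  with D pred ab show ?thesis
    by (simp add: minus_trm_def ap_Rec ap_K del: con_val.simps)
qed

end

section \<open>Typing and evaluation of the witnessing terms\<close>

lemma typed_simps [simp]:
  "typed D \<Gamma> (Var i) \<sigma> \<longleftrightarrow> i < length \<Gamma> \<and> \<sigma> = \<Gamma> ! i"
  "typed D \<Gamma> (Con c) \<sigma> \<longleftrightarrow> \<sigma> = con_type c \<and> con_type c \<in> D"
  "typed D \<Gamma> (s \<cdot> t) \<sigma> \<longleftrightarrow> (\<exists>\<rho>. typed D \<Gamma> s (\<rho> \<Rrightarrow> \<sigma>) \<and> typed D \<Gamma> t \<rho>)"
  by (auto elim: typed.cases intro: typed.intros)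

abbreviation (input) "fn_ty \<equiv> TN \<Rrightarrow> TN"
abbreviation (input) "mod_ty \<equiv> fn_ty \<Rrightarrow> Star TN"

text \<open>\<open>\<lambda>\<Psi> \<mu> h. max (\<mu> h)\<close>\<close>

definition max_wit :: trm where
  "max_wit = Con (CombK (mod_ty \<Rrightarrow> fn_ty \<Rrightarrow> TN) (fn_ty \<Rrightarrow> TN)) \<cdot>
     (Con (CombS fn_ty (Star TN) TN) \<cdot> (Con (CombK (Star TN \<Rrightarrow> TN) fn_ty) \<cdot> Con SMax))"

text \<open>\<open>\<lambda>\<Psi> \<mu> h x. \<mu> h\<close>, with \<open>x\<close> of type \<open>\<sigma>\<close>\<close>

definition modulus_wit :: "ty \<Rightarrow> trm" where
  "modulus_wit \<sigma> = Con (CombK (mod_ty \<Rrightarrow> fn_ty \<Rrightarrow> \<sigma> \<Rrightarrow> Star TN) (fn_ty \<Rrightarrow> TN)) \<cdot>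
     (Con (CombS fn_ty (Star TN) (\<sigma> \<Rrightarrow> Star TN)) \<cdot>
       (Con (CombK (Star TN \<Rrightarrow> \<sigma> \<Rrightarrow> Star TN) fn_ty) \<cdot> Con (CombK (Star TN) \<sigma>)))"

text \<open>\<open>\<lambda>\<Psi> \<mu> h H. {h}\<close>\<close>

definition point_wit :: trm where
  "point_wit = Con (CombK (mod_ty \<Rrightarrow> fn_ty \<Rrightarrow> Star fn_ty \<Rrightarrow> Star fn_ty) (fn_ty \<Rrightarrow> TN)) \<cdot>
     (Con (CombK (fn_ty \<Rrightarrow> Star fn_ty \<Rrightarrow> Star fn_ty) mod_ty) \<cdot>
       (Con (CombS fn_ty (Star fn_ty) (Star fn_ty \<Rrightarrow> Star fn_ty)) \<cdot>
         (Con (CombK (Star fn_ty \<Rrightarrow> Star fn_ty \<Rrightarrow> Star fn_ty) fn_ty) \<cdot>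
           Con (CombK (Star fn_ty) (Star fn_ty))) \<cdot>
         Con (SSing fn_ty)))"

lemma ren_wit [simp]:
  "ren r max_wit = max_wit" "ren r (modulus_wit \<sigma>) = modulus_wit \<sigma>" "ren r point_wit = point_wit"
  by (simp_all add: max_wit_def modulus_wit_def point_wit_def)

lemma ren_minus_trm: "ren r (minus_trm x y) = minus_trm (ren r x) (ren r y)"
  by (simp add: minus_trm_def pred_trm_def)

text \<open>Equivalences let the simplifier eliminate the existential argument type in the rule for
  application. Level 4 is reached by the outermost \<open>CombK\<close> of each term: its first type
  parameter takes a \<open>mod_ty\<close>, of level 2, as argument and so has level 3.\<close>

lemma typed_wit:
  assumes "{\<sigma>. level \<sigma> \<le> 4} \<subseteq> D"
  shows "typed D \<Gamma> max_wit \<tau> \<longleftrightarrow> \<tau> = (fn_ty \<Rrightarrow> TN) \<Rrightarrow> mod_ty \<Rrightarrow> fn_ty \<Rrightarrow> TN"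
    and "level \<sigma> \<le> 1 \<Longrightarrow> typed D \<Gamma> (modulus_wit \<sigma>) \<tau> \<longleftrightarrow>
      \<tau> = (fn_ty \<Rrightarrow> TN) \<Rrightarrow> mod_ty \<Rrightarrow> fn_ty \<Rrightarrow> \<sigma> \<Rrightarrow> Star TN"
    and "typed D \<Gamma> point_wit \<tau> \<longleftrightarrow>
      \<tau> = (fn_ty \<Rrightarrow> TN) \<Rrightarrow> mod_ty \<Rrightarrow> fn_ty \<Rrightarrow> Star fn_ty \<Rrightarrow> Star fn_ty"
proof -
  have l: "level \<sigma> \<le> 4 \<Longrightarrow> \<sigma> \<in> D" for \<sigma> using assms by auto
  show "typed D \<Gamma> max_wit \<tau> \<longleftrightarrow> \<tau> = (fn_ty \<Rrightarrow> TN) \<Rrightarrow> mod_ty \<Rrightarrow> fn_ty \<Rrightarrow> TN"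
    "level \<sigma> \<le> 1 \<Longrightarrow> typed D \<Gamma> (modulus_wit \<sigma>) \<tau> \<longleftrightarrow>
      \<tau> = (fn_ty \<Rrightarrow> TN) \<Rrightarrow> mod_ty \<Rrightarrow> fn_ty \<Rrightarrow> \<sigma> \<Rrightarrow> Star TN"
    "typed D \<Gamma> point_wit \<tau> \<longleftrightarrow>
      \<tau> = (fn_ty \<Rrightarrow> TN) \<Rrightarrow> mod_ty \<Rrightarrow> fn_ty \<Rrightarrow> Star fn_ty \<Rrightarrow> Star fn_ty"
    by (simp_all add: max_wit_def modulus_wit_def point_wit_def l)
qed

lemma typed_minus_trm:
  assumes "{\<sigma>. level \<sigma> \<le> 4} \<subseteq> D"
  shows "typed D \<Gamma> (minus_trm x y) \<tau> \<longleftrightarrow> \<tau> = TN \<and> typed D \<Gamma> x TN \<and> typed D \<Gamma> y TN"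
proof -
  have l: "level \<sigma> \<le> 4 \<Longrightarrow> \<sigma> \<in> D" for \<sigma> using assms by auto
  show ?thesis by (auto simp: minus_trm_def pred_trm_def l)
qed

context set_structure
begin

lemma eval_wit:
  assumes D4: "{\<sigma>. level \<sigma> \<le> 4} \<subseteq> D"
    and c: "\<Psi> \<in> carr M (fn_ty \<Rrightarrow> TN)" "\<mu> \<in> carr M mod_ty" "h \<in> carr M fn_ty"
  shows "ap M (ap M (ap M (eval M e max_wit) \<Psi>) \<mu>) h = num M (Max (nat_of M ` elems M (ap M \<mu> h)))"
    and "level \<sigma> \<le> 1 \<Longrightarrow> x \<in> carr M \<sigma> \<Longrightarrow>
      ap M (ap M (ap M (ap M (eval M e (modulus_wit \<sigma>)) \<Psi>) \<mu>) h) x = ap M \<mu> h"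
    and "H \<in> carr M (Star fn_ty) \<Longrightarrow>
      ap M (ap M (ap M (ap M (eval M e point_wit) \<Psi>) \<mu>) h) H = ap M (con_val M (SSing fn_ty)) h"
proof -
  have l: "level \<sigma> \<le> 4 \<Longrightarrow> \<sigma> \<in> D" for \<sigma> using D4 by auto
  \<comment> \<open>These intermediate values are passed on to inner constants, whose rules are
    conditional on carrier membership.\<close>
  have s: "ap M \<mu> h \<in> carr M (Star TN)" "ap M (con_val M (SSing fn_ty)) h \<in> carr M (Star fn_ty)"
    using c by (simp_all add: ap_carr[of fn_ty] SSing_carr l del: con_val.simps)
  note rules = K_carr ap_K CombS SSing_carr SMax_carr ap_SMax l c s
  show "ap M (ap M (ap M (eval M e max_wit) \<Psi>) \<mu>) h = num M (Max (nat_of M ` elems M (ap M \<mu> h)))"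
    by (simp add: max_wit_def rules del: con_val.simps)
  show "ap M (ap M (ap M (ap M (eval M e (modulus_wit \<sigma>)) \<Psi>) \<mu>) h) x = ap M \<mu> h"
    if "level \<sigma> \<le> 1" "x \<in> carr M \<sigma>"
    using that by (simp add: modulus_wit_def rules del: con_val.simps)
  show "ap M (ap M (ap M (ap M (eval M e point_wit) \<Psi>) \<mu>) h) H = ap M (con_val M (SSing fn_ty)) h"
    if "H \<in> carr M (Star fn_ty)"
    using that by (simp add: point_wit_def rules del: con_val.simps)
qed

end

section \<open>Verification of the interpretation\<close>

theorem proposition7p6:
  fixes M :: "'u struct" and D :: "ty set"
  assumes "S_omega_star D M"
    and "{\<sigma>. level \<sigma> \<le> 4} \<subseteq> D"
  shows "Icp_interpretable D (target_theory D M) pointwise_continuity"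
proof -
  interpret set_structure M D using assms(1) by unfold_locales
  have l: "level \<sigma> \<le> 4 \<Longrightarrow> \<sigma> \<in> D" for \<sigma> using assms(2) by auto
  let ?ts = "[max_wit, modulus_wit fn_ty, modulus_wit fn_ty, modulus_wit (Star fn_ty), point_wit]"
  let ?A = "relativize pointwise_continuity"
  let ?F = "alls (chal ?A) (interp id ?A ?ts (bvars (length (chal ?A))))"
  have 1: "sentence (Collect star_free) pointwise_continuity"
    by (auto simp: pointwise_continuity_def le_fm_def minus_trm_def pred_trm_def)
  have 2: "list_all2 (typed D []) ?ts (wit ?A)"
    by (simp add: pointwise_continuity_def le_fm_def funs_def typed_wit[OF assms(2)])
  note defs = pointwise_continuity_def le_fm_def funs_def alls_def bvars_def apps_def shift_def
     ren_minus_trm eval_nat_numeral Let_def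
  have 3: "sentence D ?F"
    by (simp add: defs typed_wit[OF assms(2)] typed_minus_trm[OF assms(2)] l)
  \<comment> \<open>Simplification turns \<open>?F\<close> into a statement about carriers; the
    singleton from \<open>point_wit\<close> instantiates the hypothesis on \<Phi> at h. The
    congruence rules supply the carrier hypotheses that the conditional evaluation rules
    need.\<close>
  have 4: "sat M [] ?F"
  proof (simp add: defs eval_wit[OF assms(2)] ap_carr[of fn_ty] ap_SMem SSing_carr elems_SSing
      eval_minus_trm l del: con_val.simps(1,2,4,5,7-) cong: imp_cong ball_cong bex_cong,
      intro ballI impI)
    \<comment> \<open>\<open>f\<close> no longer occurs: the hypotheses on \<open>\<Phi>\<close> and \<open>f\<close> have rewritten \<open>\<Phi> f\<close> to \<open>\<Psi> h\<close>,
      and \<open>f\<close> to \<open>h\<close> on \<open>\<mu> h\<close>.\<close>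
    fix \<Psi> \<mu> h H \<Phi>
    let ?X = "elems M (ap M \<mu> h)"
    let ?N = "num M (Max (nat_of M ` ?X))"
    assume carr: "\<mu> \<in> carr M mod_ty" "h \<in> carr M fn_ty"
      and mod: "\<forall>x\<in>carr M fn_ty.
        (\<forall>k\<in>carr M TN. k \<in> ?X \<longrightarrow> ap M x k = ap M h k) \<longrightarrow> ap M \<Phi> x = ap M \<Psi> h"
    have "finite ?X"
      using carr by (simp add: elems_carr(2)[of TN] ap_carr[of fn_ty] l)
    \<comment> \<open>This discharges the guard n \<le> N in the agreement hypothesis for every n in
      \<open>?X\<close>.\<close>
    then have le: "nat_of M k \<le> nat_of M ?N" if "k \<in> ?X" for k
      using that by simp
    show "\<exists>N\<in>carr M TN. \<forall>g'\<in>carr M fn_ty. g' \<in> elems M H \<longrightarrow> N = ?N \<and>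
      (\<forall>g\<in>carr M fn_ty. (\<forall>k\<in>carr M TN. k \<in> ?X \<longrightarrow> ap M g k = ap M g' k) \<longrightarrow>
        (\<forall>n\<in>carr M TN. n \<in> ?X \<longrightarrow> nat_of M n \<le> nat_of M N \<longrightarrow> ap M h n = ap M g' n) \<longrightarrow>
        ap M \<Psi> h = ap M \<Phi> g)"
    \<comment> \<open>One N has to serve all witnesses \<open>g'\<close> in the finite set
      \<open>H\<close> at once; \<open>?N\<close> does so because it depends only on \<mu> and
      h.\<close>
    proof (intro bexI[of _ ?N] ballI impI conjI)
      fix g g' assume "g \<in> carr M fn_ty"
        "\<forall>k\<in>carr M TN. k \<in> ?X \<longrightarrow> ap M g k = ap M g' k"
        "\<forall>n\<in>carr M TN. n \<in> ?X \<longrightarrow> nat_of M n \<le> nat_of M ?N \<longrightarrow> ap M h n = ap M g' n"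
      \<comment> \<open>On \<open>?X\<close>, g equals \<open>g'\<close> and \<open>g'\<close>
        equals h, so \<open>mod\<close> applies to g.\<close>
      then show "ap M \<Psi> h = ap M \<Phi> g"
        using mod le by simp
    qed simp_all
  qed
  show ?thesis using 1 2 3 4
    unfolding Icp_interpretable_def U_interpretable_def target_theory_def by blast
qed

end
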